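(* Let $G$ be a locally finite connected graph with growth function $\beta\colon \mathbb N \to \mathbb N$ based at some vertex. Suppose that $\beta''\colon \mathbb N\to \mathbb N$ is non-negative and non-decreasing. Then $G$ has the $\{f_n\}$-containment property with $f_n = 3 \beta''(2n)$.
   Context: $\beta(n)$ is the number of vertices at combinatorial distance at most $n$ from a fixed vertex $g_0$. For a function $\beta\colon\mathbb N\to\mathbb N$, $\beta'$ is defined by $\beta'(0)=\beta(0)$ and $\beta'(n)=\beta(n)-\beta(n-1)$ for $n\ge1$, and $\beta''=(\beta')'$. Given a finite set $X_0$ of vertices, a sequence $\{W_k\}_{k\geq1}$ of vertex sets is an $\{f_n\}$-containment strategy for $X_0$ if: (1) $|W_n|\le f_n$ for all $n\ge1$; (2) $X_n\cap W_{n+1}=\emptyset$ for all $n\ge0$, where for $n>0$, $X_n$ is the set of vertices connected to a vertex of $X_{n-1}$ by a path of length at most $1$ containing no vertex of $W_1\cup\cdots\cup W_n$; (3) there is $N>0$ with $X_n=X_N$ for all $n\ge N$. $G$ has the $\{f_n\}$-containment property if every finite vertex set admits such a strategy. *)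

theory Defs
  imports "Graph_Theory.Graph_Theory"
begin

text \<open>
  An undirected, possibly infinite graph is a symmetric digraph, an edge being represented by arcs in
  both directions. Loops and parallel edges are allowed; simple graphs are a special case.
\<close>

definition locally_finite :: "('a, 'b) pre_digraph \<Rightarrow> bool" where
  "locally_finite G \<longleftrightarrow> (\<forall>v\<in>verts G. finite (out_arcs G v))"

definition graph_dist :: "('a, 'b) pre_digraph \<Rightarrow> 'a \<Rightarrow> 'a \<Rightarrow> ereal" where
  "graph_dist G u v = wf_digraph.\<mu> G (\<lambda>_. 1) u v"

definition growth :: "('a, 'b) pre_digraph \<Rightarrow> 'a \<Rightarrow> nat \<Rightarrow> nat" where
  "growth G g0 n = card {v \<in> verts G. graph_dist G g0 v \<le> ereal (real n)}"

text \<open>The difference operator is integer-valued, because subtraction on \<^typ>\<open>nat\<close> truncates.\<close>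

definition diff_seq :: "(nat \<Rightarrow> int) \<Rightarrow> nat \<Rightarrow> int" where
  "diff_seq b n = (if n = 0 then b 0 else b n - b (n - 1))"

definition growth'' :: "('a, 'b) pre_digraph \<Rightarrow> 'a \<Rightarrow> nat \<Rightarrow> int" where
  "growth'' G g0 = diff_seq (diff_seq (\<lambda>n. int (growth G g0 n)))"

text \<open>
  The sets of the sequence \<open>W\<close> are indexed from 1 on; \<open>W 0\<close> is never used. The path in the step
  includes its starting vertex.
\<close>

primrec spread :: "('a, 'b) pre_digraph \<Rightarrow> (nat \<Rightarrow> 'a set) \<Rightarrow> 'a set \<Rightarrow> nat \<Rightarrow> 'a set" where
  "spread G W X0 0 = X0"
| "spread G W X0 (Suc n) =
     {v. \<exists>u\<in>spread G W X0 n. \<exists>p. pre_digraph.apath G u p v \<and> length p \<le> 1 \<and>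
        set (pre_digraph.awalk_verts G u p) \<inter> (\<Union>k\<in>{1..Suc n}. W k) = {}}"

text \<open>Finiteness of \<open>W n\<close> is required explicitly because \<^const>\<open>card\<close> of an infinite set is 0.\<close>

definition containment_strategy ::
    "('a, 'b) pre_digraph \<Rightarrow> (nat \<Rightarrow> int) \<Rightarrow> 'a set \<Rightarrow> (nat \<Rightarrow> 'a set) \<Rightarrow> bool" where
  "containment_strategy G f X0 W \<longleftrightarrow>
     (\<forall>n\<ge>1. W n \<subseteq> verts G) \<and>
     (\<forall>n\<ge>1. finite (W n) \<and> int (card (W n)) \<le> f n) \<and>
     (\<forall>n. spread G W X0 n \<inter> W (n + 1) = {}) \<and>
     (\<exists>N>0. \<forall>n\<ge>N. spread G W X0 n = spread G W X0 N)"

definition containment_property :: "('a, 'b) pre_digraph \<Rightarrow> (nat \<Rightarrow> int) \<Rightarrow> bool" where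
  "containment_property G f \<longleftrightarrow>
     (\<forall>X0. X0 \<subseteq> verts G \<and> finite X0 \<longrightarrow> (\<exists>W. containment_strategy G f X0 W))"

end

theory Submission
  imports Defs
begin

text \<open>
  If \<open>X\<^sub>0\<close> lies in the ball of radius \<open>r\<close>, protect the sphere of radius \<open>2 * r + 2\<close>, which the fire
  cannot reach before time \<open>r + 2\<close>. This sphere has
  \<open>\<beta>'(2 * r + 2) = \<beta>''(0) + \<dots> + \<beta>''(2 * r + 2)\<close> vertices, and by monotonicity of \<open>\<beta>''\<close> this is at
  most \<open>2 * (\<beta>''(2) + \<beta>''(4) + \<dots> + \<beta>''(2 * (r + 2)))\<close>, so the whole sphere can be protected during
  the first \<open>r + 2\<close> steps. Afterwards the fire grows inside a finite ball and hence stabilises.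
\<close>

section \<open>Balls in the graph distance and their finiteness\<close>

definition dist_ball :: "('a, 'b) pre_digraph \<Rightarrow> 'a \<Rightarrow> nat \<Rightarrow> 'a set" where
  "dist_ball G u n = {v \<in> verts G. graph_dist G u v \<le> ereal (real n)}"

lemma dist_ball_subset_verts: "dist_ball G u n \<subseteq> verts G"
  by (auto simp: dist_ball_def)

lemma dist_ball_mono:
  assumes "m \<le> n"
  shows "dist_ball G u m \<subseteq> dist_ball G u n"
proof -
  have "ereal (real m) \<le> ereal (real n)"
    using assms by simp
  then show ?thesis
    unfolding dist_ball_def by (blast intro: order_trans)
qed

context wf_digraph
begin

lemma awalk_cost_one: "awalk_cost (\<lambda>_. 1) p = real (length p)"
  by (induction p) simp_all

lemma mem_dist_ball_iff:
  "v \<in> dist_ball G u n \<longleftrightarrow> (\<exists>p. awalk u p v \<and> length p \<le> n)"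
proof
  assume "v \<in> dist_ball G u n"
  then have "\<mu> (\<lambda>_. 1) u v \<le> ereal (real n)"
    by (simp add: dist_ball_def graph_dist_def)
  \<comment> \<open>An infimum strictly below a bound has a walk strictly below it; lengths being
    integers, \<open>< n + 1\<close> then gives back \<open>\<le> n\<close>.\<close>
  also have "\<dots> < ereal (real n + 1)"
    by simp
  finally obtain p where p: "awalk u p v" "awalk_cost (\<lambda>_. 1) p < real n + 1"
    unfolding \<mu>_def by (auto simp: INF_less_iff)
  then have "length p \<le> n"
    by (simp add: awalk_cost_one)
  with p show "\<exists>p. awalk u p v \<and> length p \<le> n"
    by blast
next
  assume "\<exists>p. awalk u p v \<and> length p \<le> n"
  then obtain p where p: "awalk u p v" "length p \<le> n"
    by blast
  have "\<mu> (\<lambda>_. 1) u v \<le> ereal (real (length p))"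
    using min_cost_le_walk_cost[OF p(1), of "\<lambda>_. 1"] by (simp add: awalk_cost_one)
  also have "\<dots> \<le> ereal (real n)"
    using p(2) by simp
  finally show "v \<in> dist_ball G u n"
    using awalk_last_in_verts[OF p(1)] by (simp add: dist_ball_def graph_dist_def)
qed

lemma dist_ball_trans:
  assumes "v \<in> dist_ball G u m" "w \<in> dist_ball G v n"
  shows "w \<in> dist_ball G u (m + n)"
proof -
  obtain p q where "awalk u p v" "length p \<le> m" "awalk v q w" "length q \<le> n"
    using assms by (auto simp: mem_dist_ball_iff)
  then have "awalk u (p @ q) w \<and> length (p @ q) \<le> m + n"
    by auto
  then show ?thesis
    unfolding mem_dist_ball_iff by blast
qed

text \<open>Splits a nonempty walk at its first arc, so that finiteness follows by induction on the
  radius with varying centre.\<close>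

lemma dist_ball_Suc_subset:
  "dist_ball G u (Suc n) \<subseteq> insert u (\<Union>e\<in>out_arcs G u. dist_ball G (head G e) n)"
proof
  fix v assume "v \<in> dist_ball G u (Suc n)"
  then obtain p where p: "awalk u p v" "length p \<le> Suc n"
    by (auto simp: mem_dist_ball_iff)
  show "v \<in> insert u (\<Union>e\<in>out_arcs G u. dist_ball G (head G e) n)"
  proof (cases p)
    case Nil
    with p show ?thesis
      by (auto simp: awalk_Nil_iff)
  next
    case (Cons e es)
    with p show ?thesis
      by (auto simp: awalk_Cons_iff mem_dist_ball_iff)
  qed
qed

lemma finite_dist_ball:
  assumes "locally_finite G" "u \<in> verts G"
  shows "finite (dist_ball G u n)"
  using assms(2)
proof (induction n arbitrary: u)
  case 0
  have "dist_ball G u 0 \<subseteq> {u}"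
    by (auto simp: mem_dist_ball_iff awalk_Nil_iff)
  then show ?case
    by (rule finite_subset) simp
next
  case (Suc n)
  have "finite (out_arcs G u)"
    using assms(1) Suc.prems by (simp add: locally_finite_def)
  moreover have "finite (dist_ball G (head G e) n)" if "e \<in> out_arcs G u" for e
    using that by (intro Suc.IH) auto
  ultimately show ?case
    by (intro finite_subset[OF dist_ball_Suc_subset]) auto
qed

section \<open>Spread of the fire, and a ball containing its start\<close>

lemma spread_SucE:
  assumes "v \<in> spread G W X (Suc n)"
  obtains u where "u \<in> spread G W X n" "v \<in> dist_ball G u 1" "v \<notin> (\<Union>k\<in>{1..Suc n}. W k)"
proof -
  obtain u p where u: "u \<in> spread G W X n" and p: "apath u p v" "length p \<le> 1"
    and disj: "set (awalk_verts u p) \<inter> (\<Union>k\<in>{1..Suc n}. W k) = {}"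
    using assms by auto
  have walk: "awalk u p v"
    using p(1) by (simp add: apath_def)
  then have "v \<in> set (awalk_verts u p)"
    by (metis awalkE awalk_verts_non_Nil last_in_set)
  with u p(2) walk disj show thesis
    by (intro that[of u]) (auto simp: mem_dist_ball_iff)
qed

text \<open>The trivial path keeps a burning vertex burning. Since \<open>spread\<close> excludes
  earlier protected sets as well, \<open>disj\<close> ranges over all of them.\<close>

lemma spread_subset_spread_Suc:
  assumes X: "X \<subseteq> verts G"
    and disj: "\<And>k. spread G W X n \<inter> W (Suc k) = {}"
  shows "spread G W X n \<subseteq> spread G W X (Suc n)"
proof
  fix v assume v: "v \<in> spread G W X n"
  have "v \<in> verts G"
  proof (cases n)
    case 0
    with v X show ?thesis by auto
  next
    case (Suc k)
    with v show ?thesis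
      using dist_ball_subset_verts by (metis spread_SucE subsetD)
  qed
  then have "apath v [] v"
    by (simp add: apath_Nil_iff)
  moreover have "v \<notin> W k" if "k \<in> {1..Suc n}" for k
    using disj[of "k - 1"] v that by auto
  ultimately show "v \<in> spread G W X (Suc n)"
    using v by (auto intro!: bexI[of _ v] exI[of _ "[]"])
qed

lemma finite_subset_dist_ballE:
  assumes "\<And>v. v \<in> X \<Longrightarrow> u \<rightarrow>\<^sup>* v" "finite X"
  obtains r where "X \<subseteq> dist_ball G u r"
proof -
  have "\<exists>r. X \<subseteq> dist_ball G u r"
    using assms(2,1)
  proof (induction X)
    case empty
    then show ?case by simp
  next
    case (insert v X)
    then obtain r where r: "X \<subseteq> dist_ball G u r"
      by blast
    obtain p where p: "awalk u p v"
      using insert.prems by (auto simp: reachable_awalk)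
    have "v \<in> dist_ball G u (max r (length p))"
      using p by (auto simp: mem_dist_ball_iff)
    moreover have "X \<subseteq> dist_ball G u (max r (length p))"
      using r dist_ball_mono[of r "max r (length p)"] by fastforce
    ultimately show ?case
      by blast
  qed
  with that show thesis by blast
qed

end

section \<open>Finite sets: stabilisation, and distribution within budgets\<close>

text \<open>The cardinalities attain a maximum at some \<open>N\<close>; every later set contains
  \<open>X N\<close> and is no larger, hence equal to it.\<close>

lemma bounded_incseq_of_sets_stabilises:
  fixes X :: "nat \<Rightarrow> 'a set"
  assumes "finite B" "\<And>n. X n \<subseteq> B" "\<And>n. X n \<subseteq> X (Suc n)"
  shows "\<exists>N>0. \<forall>n\<ge>N. X n = X N"
proof -
  have mono: "X m \<subseteq> X n" if "m \<le> n" for m n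
    using assms(3) that by (rule lift_Suc_mono_le)
  have fin: "finite (X n)" for n
    using assms(1,2) finite_subset by blast
  have "finite (range X)"
    using assms(1,2) by (intro finite_subset[of "range X" "Pow B"]) auto
  then have finite_cards: "finite (range (\<lambda>n. card (X n)))"
    by (metis finite_imageI image_image)
  define M where "M = Max (range (\<lambda>n. card (X n)))"
  have "M \<in> range (\<lambda>n. card (X n))"
    unfolding M_def using finite_cards by (intro Max_in) auto
  then obtain N where N: "card (X N) = M"
    by auto
  have "X N = X n" if "N \<le> n" for n
  proof (rule card_subset_eq[OF fin mono[OF that]])
    have "card (X n) \<le> M"
      unfolding M_def using finite_cards by (intro Max_ge) auto
    with N show "card (X N) = card (X n)"
      using card_mono[OF fin mono[OF that]] by linarith
  qed
  then show ?thesis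
    \<comment> \<open>\<open>Suc N\<close> because \<open>N\<close> may be 0.\<close>
    by (intro exI[of _ "Suc N"]) (metis Suc_leD le_refl zero_less_Suc)
qed

text \<open>Greedy from the last index down: \<open>Suc m\<close> takes as much of \<open>S\<close>
  as its budget allows, and the induction hypothesis distributes the rest.\<close>

lemma finite_set_distribute:
  fixes f :: "nat \<Rightarrow> int"
  assumes "finite S" "\<And>n. 0 \<le> f n" "int (card S) \<le> (\<Sum>n=1..m. f n)"
  shows "\<exists>W. (\<forall>n. W n \<subseteq> S \<and> int (card (W n)) \<le> f n) \<and> (\<Union>n\<in>{1..m}. W n) = S"
  using assms(1,3)
proof (induction m arbitrary: S)
  case 0
  then show ?case
    using assms(2) by (intro exI[of _ "\<lambda>_. {}"]) auto
next
  case (Suc m)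
  define c where "c = min (card S) (nat (f (Suc m)))"
  obtain T where T: "T \<subseteq> S" "card T = c" "finite T"
    using obtain_subset_with_card_n[of c S] unfolding c_def by auto
  have T_le: "int (card T) \<le> f (Suc m)"
    using T(2) assms(2)[of "Suc m"] by (auto simp: c_def)
  \<comment> \<open>Either \<open>T\<close> exhausts \<open>S\<close>, or it uses the whole budget
    \<open>f (Suc m)\<close>, which then cancels on both sides.\<close>
  have "int (card (S - T)) \<le> (\<Sum>n=1..m. f n)"
  proof -
    have "int (card (S - T)) = int (card S) - int c"
      using T Suc.prems(1) by (simp add: card_Diff_subset c_def of_nat_diff)
    moreover have "0 \<le> (\<Sum>n=1..m. f n)"
      using assms(2) by (simp add: sum_nonneg)
    ultimately show ?thesis
      using Suc.prems(2) assms(2)[of "Suc m"] by (auto simp: c_def min_def split: if_splits)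
  qed
  with Suc.IH[of "S - T"] Suc.prems(1) obtain W where
    W: "\<forall>n. W n \<subseteq> S - T \<and> int (card (W n)) \<le> f n" "(\<Union>n\<in>{1..m}. W n) = S - T"
    by auto
  have "(\<Union>n\<in>{1..Suc m}. (W(Suc m := T)) n) = T \<union> (\<Union>n\<in>{1..m}. W n)"
    by (auto simp: atLeastAtMostSuc_conv)
  also have "\<dots> = S"
    using W(2) T(1) by auto
  finally show ?case
    using W(1) T(1) T_le by (intro exI[of _ "W(Suc m := T)"]) auto
qed

section \<open>Sphere sizes from second differences\<close>

text \<open>Telescoping; the value \<open>b 0\<close> at index 0 leaves no constant term.\<close>

lemma sum_diff_seq: "(\<Sum>j\<le>n. diff_seq b j) = b n"
  by (induction n) (simp_all add: diff_seq_def)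

text \<open>Each odd index is paired with the next even one, where \<open>g\<close> is at least as
  large; index 0 stays unpaired.\<close>

lemma sum_le_twice_sum_even:
  fixes g :: "nat \<Rightarrow> int"
  assumes "mono g"
  shows "(\<Sum>j\<le>2 * k. g j) \<le> g 0 + 2 * (\<Sum>n=1..k. g (2 * n))"
proof (induction k)
  case 0
  then show ?case by simp
next
  case (Suc k)
  have "g (Suc (2 * k)) \<le> g (2 * Suc k)"
    using assms by (simp add: monoD)
  with Suc.IH show ?case by simp
qed

lemma card_sphere_le:
  assumes finite: "\<And>n. finite (dist_ball G g0 n)"
    and nonneg: "\<And>n. 0 \<le> growth'' G g0 n" and mono: "mono (growth'' G g0)"
  shows "int (card (dist_ball G g0 (2 * r + 2) - dist_ball G g0 (2 * r + 1)))
    \<le> (\<Sum>n=1..r + 2. 3 * growth'' G g0 (2 * n))"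
proof -
  let ?g = "growth'' G g0" and ?B = "dist_ball G g0"
  have ball_mono: "?B (2 * r + 1) \<subseteq> ?B (2 * r + 2)"
    by (rule dist_ball_mono) simp
  have "int (card (?B (2 * r + 2) - ?B (2 * r + 1)))
      = int (card (?B (2 * r + 2))) - int (card (?B (2 * r + 1)))"
    using card_Diff_subset[OF finite ball_mono] card_mono[OF finite ball_mono]
    by (simp only: of_nat_diff)
  also have "\<dots> = diff_seq (\<lambda>n. int (growth G g0 n)) (2 * r + 2)"
    by (simp add: diff_seq_def growth_def dist_ball_def)
  also have "\<dots> = (\<Sum>j\<le>2 * (r + 1). ?g j)"
    unfolding growth''_def sum_diff_seq by simp
  also have "\<dots> \<le> ?g 0 + 2 * (\<Sum>n=1..r + 1. ?g (2 * n))"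
    using mono by (rule sum_le_twice_sum_even)
  \<comment> \<open>Monotonicity moves the unpaired \<open>?g 0\<close> into the budget of step
    \<open>r + 2\<close>; nonnegativity allows the factor 3.\<close>
  also have "\<dots> \<le> ?g (2 * (r + 2)) + 3 * (\<Sum>n=1..r + 1. ?g (2 * n))"
    using monoD[OF mono, of 0 "2 * (r + 2)"] sum_nonneg[of "{1..r + 1}" "\<lambda>n. ?g (2 * n)"] nonneg
    by simp
  also have "\<dots> \<le> 3 * (\<Sum>n=1..r + 2. ?g (2 * n))"
    using nonneg[of "2 * (r + 2)"] by simp
  finally show ?thesis
    by (simp add: sum_distrib_left)
qed

section \<open>Protecting a sphere of even radius\<close>

theorem theorem2p8:
  fixes G :: "('a, 'b) pre_digraph" and g0 :: 'a
  assumes "sym_digraph G"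
    and "Digraph_Component.connected G"
    and "locally_finite G"
    and "g0 \<in> verts G"
    and "\<forall>n. 0 \<le> growth'' G g0 n"
    and "mono (growth'' G g0)"
  shows "containment_property G (\<lambda>n. 3 * growth'' G g0 (2 * n))"
  unfolding containment_property_def
proof (intro allI impI)
  fix X0 assume X0: "X0 \<subseteq> verts G \<and> finite X0"
  interpret sym_digraph G by fact
  let ?f = "\<lambda>n. 3 * growth'' G g0 (2 * n)" and ?B = "dist_ball G g0"
  have fin: "finite (?B n)" for n
    using assms(3,4) by (rule finite_dist_ball)
  \<comment> \<open>Connectedness speaks of the symmetric closure; as the arcs are symmetric,
    reachability in \<open>G\<close> is the same.\<close>
  have "g0 \<rightarrow>\<^sup>*\<^bsub>G\<^esub> v" if "v \<in> X0" for v
    using assms(2,4) X0 that sym_arcs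
    by (auto simp: connected_def strongly_connected_def reachable_mk_symmetric_eq)
  then obtain r where r: "X0 \<subseteq> ?B r"
    using X0 finite_subset_dist_ballE by blast
  \<comment> \<open>The even radius suits the pairing of indices. At time \<open>r + 1\<close> the
    fire is still within distance \<open>2 * r + 1\<close>.\<close>
  define S where "S = ?B (2 * r + 2) - ?B (2 * r + 1)"
  have finS: "finite S"
    using fin by (simp add: S_def)
  have "int (card S) \<le> sum ?f {1..r + 2}"
    unfolding S_def using fin assms(5,6) by (intro card_sphere_le) auto
  moreover have "0 \<le> ?f n" for n
    using assms(5) by simp
  ultimately have "\<exists>W. (\<forall>n. W n \<subseteq> S \<and> int (card (W n)) \<le> ?f n) \<and> (\<Union>n\<in>{1..r + 2}. W n) = S"
    by (intro finite_set_distribute[where f = ?f, OF finS])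
  then obtain W where W: "\<And>n. W n \<subseteq> S" "\<And>n. int (card (W n)) \<le> ?f n"
    and cover: "(\<Union>n\<in>{1..r + 2}. W n) = S"
    by blast
  \<comment> \<open>\<open>r + n\<close> is the unhindered speed of the fire; the cap
    \<open>2 * r + 1\<close> is reached at \<open>n = r + 1\<close>, and from the next step on all
    of \<open>S\<close> is protected.\<close>
  have bound: "spread G W X0 n \<subseteq> ?B (min (r + n) (2 * r + 1))" for n
  proof (induction n)
    case 0
    then show ?case
      using r by simp
  next
    case (Suc n)
    show ?case
    proof
      fix v assume "v \<in> spread G W X0 (Suc n)"
      then obtain u where u: "u \<in> spread G W X0 n" "v \<in> dist_ball G u 1"
        and v: "v \<notin> (\<Union>k\<in>{1..Suc n}. W k)"
        by (rule spread_SucE)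
      have step: "v \<in> ?B (min (r + n) (2 * r + 1) + 1)"
        using u Suc.IH dist_ball_trans by blast
      show "v \<in> ?B (min (r + Suc n) (2 * r + 1))"
      proof (cases "n \<le> r")
        case True
        with step show ?thesis by simp
      next
        \<comment> \<open>Now \<open>Suc n \<ge> r + 2\<close>, so
          \<open>W 1, ..., W (Suc n)\<close> cover \<open>S\<close>, and a vertex of the ball of
          radius \<open>2 * r + 2\<close> outside \<open>S\<close> lies in the ball of radius
          \<open>2 * r + 1\<close>.\<close>
        case False
        then have "S \<subseteq> (\<Union>k\<in>{1..Suc n}. W k)"
          unfolding cover[symmetric] by (intro UN_mono) auto
        with v have "v \<notin> S"
          by blast
        with step False show ?thesis by (simp add: S_def)
      qed
    qed
  qed
  have inside: "spread G W X0 n \<subseteq> ?B (2 * r + 1)" for n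
    using bound[of n] dist_ball_mono[of "min (r + n) (2 * r + 1)" "2 * r + 1" G g0] by auto
  \<comment> \<open>Disjointness from every \<open>W k\<close>, not just from
    \<open>W (n + 1)\<close>, is what makes the burning sets increase.\<close>
  have disj: "spread G W X0 n \<inter> W k = {}" for n k
    using inside[of n] W(1)[of k] by (auto simp: S_def)
  have "W n \<subseteq> verts G" for n
    using W(1)[of n] dist_ball_subset_verts[of G g0] by (auto simp: S_def)
  moreover have "finite (W n)" for n
    using W(1) finS by (rule finite_subset)
  moreover have "\<exists>N>0. \<forall>n\<ge>N. spread G W X0 n = spread G W X0 N"
    using fin inside by (rule bounded_incseq_of_sets_stabilises)
      (use X0 disj in \<open>intro spread_subset_spread_Suc, auto\<close>)
  ultimately show "\<exists>W. containment_strategy G ?f X0 W"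
    unfolding containment_strategy_def using W(2) disj by (intro exI[of _ W] conjI allI impI)
qed

end
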